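(* Let $(X,\rho)$ be a partial metric space, let $\alpha,\theta$ be real numbers with $0<\alpha<\theta\le 1$, let $0<q<\infty$, and let $x\in X$. If a sequence in $X$ is strongly $q$-Cesàro summable of order $\alpha$ to $x$, then it is $\rho$-statistically convergent of order $\theta$ to $x$.
   Context: A partial metric on a non-empty set $X$ is a function $\rho:X\times X\to\mathbb{R}$ such that for all $x,y,z\in X$: (i) $0\le\rho(x,x)\le\rho(x,y)$; (ii) if $\rho(x,x)=\rho(x,y)=\rho(y,y)$ then $x=y$; (iii) $\rho(x,y)=\rho(y,x)$; (iv) $\rho(x,z)\le\rho(x,y)+\rho(y,z)-\rho(y,y)$. The pair $(X,\rho)$ is called a partial metric space. Sequences are indexed by $\mathbb{N}=\{1,2,3,\dots\}$. For $q>0$ and $\alpha\in(0,1]$, a sequence $(x_k)$ in $X$ is strongly $q$-Cesàro summable of order $\alpha$ to $x\in X$ if $\lim_{n\to\infty}\frac{1}{n^\alpha}\sum_{k=1}^n|\rho(x_k,x)-\rho(x,x)|^q=0$. For $\theta\in(0,1]$, a sequence $(x_k)$ in $X$ is $\rho$-statistically convergent of order $\theta$ to $x\in X$ if for every $\varepsilon>0$, $\lim_{n\to\infty}\frac{1}{n^\theta}\left|\{k\le n:|\rho(x_k,x)-\rho(x,x)|\ge\varepsilon\}\right|=0$, where $|\cdot|$ of a set denotes its cardinality. *)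

theory Defs
  imports Complex_Main
begin

locale partial_metric_space =
  fixes X :: "'a set" and \<rho> :: "'a \<Rightarrow> 'a \<Rightarrow> real"
  assumes nonempty: "X \<noteq> {}"
    and self_nonneg: "x \<in> X \<Longrightarrow> 0 \<le> \<rho> x x"
    and self_le: "x \<in> X \<Longrightarrow> y \<in> X \<Longrightarrow> \<rho> x x \<le> \<rho> x y"
    and eq_if_self_eq:
      "x \<in> X \<Longrightarrow> y \<in> X \<Longrightarrow> \<rho> x x = \<rho> x y \<Longrightarrow> \<rho> x y = \<rho> y y \<Longrightarrow> x = y"
    and commute: "x \<in> X \<Longrightarrow> y \<in> X \<Longrightarrow> \<rho> x y = \<rho> y x"
    and triangle:
      "x \<in> X \<Longrightarrow> y \<in> X \<Longrightarrow> z \<in> X \<Longrightarrow> \<rho> x z \<le> \<rho> x y + \<rho> y z - \<rho> y y"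

(* Sequences are indexed by the positive integers: the value at index 0 is never used. *)

definition strongly_cesaro_summable ::
    "('a \<Rightarrow> 'a \<Rightarrow> real) \<Rightarrow> real \<Rightarrow> real \<Rightarrow> (nat \<Rightarrow> 'a) \<Rightarrow> 'a \<Rightarrow> bool"
  where "strongly_cesaro_summable \<rho> q \<alpha> s x \<longleftrightarrow>
    (\<lambda>n::nat. 1 / real n powr \<alpha> * (\<Sum>k=1..n. \<bar>\<rho> (s k) x - \<rho> x x\<bar> powr q))
      \<longlonglongrightarrow> 0"

definition statistically_convergent ::
    "('a \<Rightarrow> 'a \<Rightarrow> real) \<Rightarrow> real \<Rightarrow> (nat \<Rightarrow> 'a) \<Rightarrow> 'a \<Rightarrow> bool"
  where "statistically_convergent \<rho> \<theta> s x \<longleftrightarrow>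
    (\<forall>\<epsilon>>0. (\<lambda>n::nat. 1 / real n powr \<theta> *
        real (card {k \<in> {1..n}. \<bar>\<rho> (s k) x - \<rho> x x\<bar> \<ge> \<epsilon>})) \<longlonglongrightarrow> 0)"

end

theory Submission
  imports Defs
begin

text \<open>The argument is Chebyshev's inequality for the counting measure on \<open>{1..n}\<close>: each index \<open>k\<close>
  at which the deviation \<open>\<bar>\<rho> (s k) x - \<rho> x x\<bar>\<close> reaches \<open>\<epsilon>\<close> contributes at least \<open>\<epsilon>\<^sup>q\<close> to the
  Cesaro sum. Hence the number of such indices is at most \<open>\<epsilon>\<close> to the power \<open>-q\<close> times that sum.
  Since \<open>n\<close> to the power \<open>\<theta>\<close> dominates \<open>n\<close> to the power \<open>\<alpha>\<close> for \<open>n \<ge> 1\<close>, the density of order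
  \<open>\<theta>\<close> is squeezed between \<open>0\<close> and a constant multiple of the Cesaro mean of order \<open>\<alpha>\<close>.\<close>

lemma chebyshev_card_powr:
  fixes f :: "'b \<Rightarrow> real"
  assumes "finite A" and "0 < \<epsilon>" and "0 \<le> q"
  shows "\<epsilon> powr q * real (card {k \<in> A. \<epsilon> \<le> f k}) \<le> (\<Sum>k\<in>A. f k powr q)"
proof -
  have "\<epsilon> powr q * real (card {k \<in> A. \<epsilon> \<le> f k}) = (\<Sum>k | k \<in> A \<and> \<epsilon> \<le> f k. \<epsilon> powr q)"
    by simp
  also have "\<dots> \<le> (\<Sum>k | k \<in> A \<and> \<epsilon> \<le> f k. f k powr q)"
    using assms by (intro sum_mono powr_mono2) auto
  also have "\<dots> \<le> (\<Sum>k\<in>A. f k powr q)"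
    using assms(1) by (intro sum_mono2) auto
  finally show ?thesis .
qed

theorem theorem2p7:
  fixes X :: "'a set" and \<rho> :: "'a \<Rightarrow> 'a \<Rightarrow> real"
    and \<alpha> \<theta> q :: real and s :: "nat \<Rightarrow> 'a" and x :: 'a
  assumes "partial_metric_space X \<rho>"
    and "0 < \<alpha>" and "\<alpha> < \<theta>" and "\<theta> \<le> 1"
    and "0 < q"
    and "x \<in> X"
    and "\<And>k. 1 \<le> k \<Longrightarrow> s k \<in> X"
    and "strongly_cesaro_summable \<rho> q \<alpha> s x"
  shows "statistically_convergent \<rho> \<theta> s x"
  unfolding statistically_convergent_def
proof (intro allI impI)
  fix \<epsilon> :: real
  assume "0 < \<epsilon>"
  define d where "d k = \<bar>\<rho> (s k) x - \<rho> x x\<bar>" for k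
  define c where "c n = real (card {k \<in> {1..n}. \<epsilon> \<le> d k})" for n
  define S where "S n = (\<Sum>k=1..n. d k powr q)" for n
  have "(\<lambda>n. 1 / real n powr \<alpha> * S n) \<longlonglongrightarrow> 0"
    using assms(8) by (simp add: strongly_cesaro_summable_def d_def S_def)
  then have lim: "(\<lambda>n. 1 / real n powr \<alpha> * S n / \<epsilon> powr q) \<longlonglongrightarrow> 0"
    by (rule tendsto_divide_zero)
  have bound: "1 / real n powr \<theta> * c n \<le> 1 / real n powr \<alpha> * S n / \<epsilon> powr q" if "1 \<le> n" for n
  proof -
    have "c n \<le> S n / \<epsilon> powr q"
      using chebyshev_card_powr[of "{1..n}" \<epsilon> q d] \<open>0 < \<epsilon>\<close> \<open>0 < q\<close>
      by (simp add: c_def S_def field_simps)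
    moreover have "1 / real n powr \<theta> \<le> 1 / real n powr \<alpha>"
      using that \<open>\<alpha> < \<theta>\<close> by (intro divide_left_mono powr_mono) auto
    ultimately have "1 / real n powr \<theta> * c n \<le> 1 / real n powr \<alpha> * (S n / \<epsilon> powr q)"
      by (intro mult_mono) (auto simp: c_def)
    then show ?thesis by simp
  qed
  have "(\<lambda>n. 1 / real n powr \<theta> * c n) \<longlonglongrightarrow> 0"
  proof (rule tendsto_sandwich[OF _ _ tendsto_const lim])
    show "\<forall>\<^sub>F n in sequentially. 0 \<le> 1 / real n powr \<theta> * c n"
      by (simp add: c_def)
    show "\<forall>\<^sub>F n in sequentially.
        1 / real n powr \<theta> * c n \<le> 1 / real n powr \<alpha> * S n / \<epsilon> powr q"
      using eventually_ge_at_top[of 1] by eventually_elim (rule bound)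
  qed
  then show "(\<lambda>n. 1 / real n powr \<theta> *
      real (card {k \<in> {1..n}. \<bar>\<rho> (s k) x - \<rho> x x\<bar> \<ge> \<epsilon>})) \<longlonglongrightarrow> 0"
    by (simp add: c_def d_def)
qed

end
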